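(* Let $Q(\tau)=\theta\begin{bmatrix}3/5\\3/5\end{bmatrix}(0,\tau)\,\theta\begin{bmatrix}3/5\\7/5\end{bmatrix}(0,\tau)$. For every $M=\begin{pmatrix} a&b\\ c&d\end{pmatrix}\in\Gamma_{\theta,5}$ and $\tau\in\mathscr{H}$, $Q(M\tau)=\nu(M)(c\tau+d)Q(\tau)$ with $\nu(M)=\nu_\eta^6(M)\exp\!\left(\frac{\pi i}{5}E\right)$, where $E=-\frac{6b}{5}-\frac{2ab}{5}-\frac{2cd}{5}$ if $M\equiv\begin{pmatrix}1&0\\0&1\end{pmatrix}\pmod 5$; $E=-\frac{24b}{5}-\frac{2ab}{5}-\frac{2cd}{5}$ if $M\equiv\begin{pmatrix}-1&0\\0&-1\end{pmatrix}\pmod 5$; $E=-5-\frac{6d}{5}-\frac{2ab}{5}-\frac{2cd}{5}$ if $M\equiv\begin{pmatrix}0&-1\\1&0\end{pmatrix}\pmod 5$; $E=-5+\frac{6d}{5}-\frac{2ab}{5}-\frac{2cd}{5}$ if $M\equiv\begin{pmatrix}0&1\\-1&0\end{pmatrix}\pmod 5$.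
   Context: $\mathscr{H}$ is the upper half plane, $M\tau=\frac{a\tau+b}{c\tau+d}$. $\theta\begin{bmatrix}\epsilon\\ \epsilon'\end{bmatrix}(v,\tau)=\sum_{n\in\mathbb{Z}}\exp\!\Big(2\pi i\Big[\tfrac12\big(n+\tfrac{\epsilon}{2}\big)^2\tau+\big(n+\tfrac{\epsilon}{2}\big)\big(v+\tfrac{\epsilon'}{2}\big)\Big]\Big)$. $\Gamma_{\theta,5}=\{M\in SL(2,\mathbb{Z}): M\equiv\pm\begin{pmatrix}1&0\\0&1\end{pmatrix}\text{ or }\pm\begin{pmatrix}0&-1\\1&0\end{pmatrix}\pmod 5\}$. $\eta(\tau)=q^{1/24}\prod_{n\ge1}(1-q^n)$, $q=e^{2\pi i\tau}$; $\nu_\eta$ is its multiplier system, $\eta(M\tau)=\nu_\eta(M)(c\tau+d)^{1/2}\eta(\tau)$ with branch $-\pi\le\arg(c\tau+d)<\pi$; explicitly $\nu_\eta(M)=\left(\frac{d}{c}\right)^{*}\exp\{\frac{\pi i}{12}[(a+d)c-bd(c^2-1)-3c]\}$ if $c$ odd, $\nu_\eta(M)=\left(\frac{c}{d}\right)_{*}\exp\{\frac{\pi i}{12}[(a+d)c-bd(c^2-1)+3d-3-3cd]\}$ if $c$ even, with $\left(\frac{c}{d}\right)^{*}=\left(\frac{c}{|d|}\right)$, $\left(\frac{c}{d}\right)_{*}=\left(\frac{c}{|d|}\right)(-1)^{\frac{\operatorname{sign}c-1}{2}\frac{\operatorname{sign}d-1}{2}}$ (Jacobi symbols). *)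

theory Defs
  imports "HOL-Analysis.Analysis" "HOL-Number_Theory.Number_Theory"
begin

definition theta_char :: "real \<Rightarrow> real \<Rightarrow> complex \<Rightarrow> complex \<Rightarrow> complex" where
  "theta_char eps eps' v \<tau> =
     (\<Sum>\<^sub>\<infinity>n::int. exp (2 * pi * \<i> *
        ((1/2) * (of_int n + of_real eps / 2)^2 * \<tau>
         + (of_int n + of_real eps / 2) * (v + of_real eps' / 2))))"

definition jacobi :: "int \<Rightarrow> int \<Rightarrow> int" where
  "jacobi a n = prod_mset (image_mset (Legendre a) (prime_factorization n))"

text \<open>(c/d)^* and (c/d)_* as in the paper; for c = 0 the standard convention
  (0/d)_* = sgn d (d = +-1) is used.\<close>
definition jac_upper :: "int \<Rightarrow> int \<Rightarrow> int" where
  "jac_upper c d = jacobi c \<bar>d\<bar>"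

definition jac_lower :: "int \<Rightarrow> int \<Rightarrow> int" where
  "jac_lower c d = (if c = 0 then sgn d
     else jacobi c \<bar>d\<bar> * (if c < 0 \<and> d < 0 then -1 else 1))"

text \<open>Multiplier system of the Dedekind eta function, explicit formula.\<close>
definition nu_eta :: "int \<Rightarrow> int \<Rightarrow> int \<Rightarrow> int \<Rightarrow> complex" where
  "nu_eta a b c d =
    (if odd c then
       of_int (jac_upper d c) *
         exp (pi * \<i> / 12 * of_int ((a + d) * c - b * d * (c^2 - 1) - 3 * c))
     else
       of_int (jac_lower c d) *
         exp (pi * \<i> / 12 * of_int ((a + d) * c - b * d * (c^2 - 1) + 3 * d - 3 - 3 * c * d)))"

definition in_Gamma_theta5 :: "int \<Rightarrow> int \<Rightarrow> int \<Rightarrow> int \<Rightarrow> bool" where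
  "in_Gamma_theta5 a b c d \<longleftrightarrow> a * d - b * c = 1 \<and>
     (([a = 1] (mod 5) \<and> [b = 0] (mod 5) \<and> [c = 0] (mod 5) \<and> [d = 1] (mod 5)) \<or>
      ([a = -1] (mod 5) \<and> [b = 0] (mod 5) \<and> [c = 0] (mod 5) \<and> [d = -1] (mod 5)) \<or>
      ([a = 0] (mod 5) \<and> [b = -1] (mod 5) \<and> [c = 1] (mod 5) \<and> [d = 0] (mod 5)) \<or>
      ([a = 0] (mod 5) \<and> [b = 1] (mod 5) \<and> [c = -1] (mod 5) \<and> [d = 0] (mod 5)))"

definition Qf :: "complex \<Rightarrow> complex" where
  "Qf \<tau> = theta_char (3/5) (3/5) 0 \<tau> * theta_char (3/5) (7/5) 0 \<tau>"

definition mobius_act :: "int \<Rightarrow> int \<Rightarrow> int \<Rightarrow> int \<Rightarrow> complex \<Rightarrow> complex" where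
  "mobius_act a b c d \<tau> = (of_int a * \<tau> + of_int b) / (of_int c * \<tau> + of_int d)"

end

(* Write Q as a product of two Klein forms k_v, where v = (p, r) is a row vector of real
   characteristics and k_v is theta with characteristic (1/2 + p, 1/2 + r), normalised by a
   phase so that T acts by k_v(tau + 1) = e^(pi i/4) k_(vT)(tau) and S by
   k_v(-1/tau) = -i sqrt(-i tau) k_(vS)(tau).  The S-rule is Poisson summation on the imaginary
   axis, continued analytically to the half plane.  A product of two Klein forms therefore
   transforms under SL(2,Z) with weight one and a character taking T and S to i, and this
   character is the sixth power of the eta multiplier.  For M in Gamma_(theta,5) the two
   vectors -1/5 (1, 1) and 1/5 (-1, 1) are permuted by M up to sign and integer vectors;
   shifting by these gives the fifth roots of unity in the multiplier. *)

theory Submission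
  imports Defs "HOL-Probability.Characteristic_Functions" "HOL-Complex_Analysis.Complex_Analysis"
begin

section \<open>Theta series with real characteristics\<close>

text \<open>The sixth power of nu_eta has a structural origin: k_v is a constant times eta^3 times
  the classical Klein form at v. Classical Klein forms have weight -1 and no multiplier under
  SL(2,Z), so a product of two leaves weight 3 - 2 = 1 and the multiplier of eta^6. The proof does
  not pass through eta as a function; it compares how the explicit exponent of \<open>nu_eta\<close>
  and the product of Klein forms change under T and S. The obstacle is the choice of signs. A single
  form carries a square root whose branches would have to be followed through compositions; pairing
  two forms squares it away. On the eta side the sixth power removes the Jacobi symbols, so no
  reciprocity law is needed and only an integer exponent modulo 4 remains. For Poisson summation,
  theta at tau = i s is read as a periodic function of its first characteristic x. This makes both
  sides continuous functions on a circle, and the identity becomes uniqueness of Fourier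
  coefficients.\<close>

lemma summable_gauss_int:
  fixes c :: real
  assumes "c > 0"
  shows "(\<lambda>n::int. exp (- c * of_int n ^ 2)) summable_on UNIV"
proof -
  let ?g = "\<lambda>n::int. exp (- c * of_int n ^ 2)"
  have nat: "(\<lambda>n::nat. exp (- c * real n ^ 2)) summable_on UNIV"
  proof (rule norm_summable_imp_summable_on, rule summable_comparison_test')
    show "summable (\<lambda>n. exp (- c) ^ n)"
      using assms by (simp add: summable_geometric)
    fix n :: nat
    have "real n \<le> real n ^ 2"
      by (cases n) (auto simp: power2_eq_square)
    then have "c * real n \<le> c * real n ^ 2" using assms by simp
    then show "norm (norm (exp (- c * real n ^ 2))) \<le> exp (- c) ^ n"
      by (subst exp_of_nat_mult[symmetric]) (simp add: mult.commute)
  qed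
  have "?g summable_on range int"
    by (subst summable_on_reindex) (use nat in \<open>auto simp: o_def\<close>)
  moreover have "?g summable_on range (\<lambda>n. - int n)"
    by (subst summable_on_reindex) (use nat in \<open>auto simp: o_def inj_on_def\<close>)
  moreover have "range int \<union> range (\<lambda>n. - int n) = UNIV"
  proof -
    have "n \<in> range int \<union> range (\<lambda>n. - int n)" for n :: int
      by (cases n rule: int_cases2) auto
    then show ?thesis by blast
  qed
  ultimately show ?thesis
    by (metis summable_on_union)
qed

definition theta_term :: "real \<Rightarrow> real \<Rightarrow> complex \<Rightarrow> int \<Rightarrow> complex" where
  "theta_term x y \<tau> n =
     exp (pi * \<i> * (of_real (of_int n + x) ^ 2 * \<tau> + of_real (2 * (of_int n + x) * y)))"

definition theta :: "real \<Rightarrow> real \<Rightarrow> complex \<Rightarrow> complex" where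
  "theta x y \<tau> = (\<Sum>\<^sub>\<infinity>n. theta_term x y \<tau> n)"

lemma theta_char_eq_theta: "theta_char e e' 0 \<tau> = theta (e / 2) (e' / 2) \<tau>"
  unfolding theta_char_def theta_def theta_term_def
  by (intro infsum_cong arg_cong[of _ _ exp]) (simp add: algebra_simps power2_eq_square)

lemma norm_theta_term: "norm (theta_term x y \<tau> n) = exp (- pi * (of_int n + x) ^ 2 * Im \<tau>)"
  unfolding theta_term_def norm_exp_eq_Re
  by (simp add: power2_eq_square algebra_simps)

definition theta_bound :: "real \<Rightarrow> real \<Rightarrow> int \<Rightarrow> real" where
  "theta_bound c R n = exp (pi * c * R ^ 2) * exp (- (pi * c / 2) * of_int n ^ 2)"

lemma summable_theta_bound: "c > 0 \<Longrightarrow> theta_bound c R summable_on UNIV"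
  unfolding theta_bound_def by (intro summable_on_cmult_right summable_gauss_int) simp

text \<open>Completing the square gives (n + x)^2 = n^2/2 - x^2 + (n + 2x)^2/2. The majorant depends
  neither on x in [-R, R] nor on tau with Im tau at least c, so it yields uniform convergence in
  either variable.\<close>

lemma norm_theta_term_le:
  assumes "\<bar>x\<bar> \<le> R" "c \<le> Im \<tau>" "c > 0"
  shows "norm (theta_term x y \<tau> n) \<le> theta_bound c R n"
proof -
  have "x ^ 2 \<le> R ^ 2"
    using assms(1) by (metis abs_ge_zero power2_abs power_mono)
  moreover have "0 \<le> (of_int n + 2 * x) ^ 2" by simp
  ultimately have "of_int n ^ 2 / 2 - R ^ 2 \<le> (of_int n + x) ^ 2"
    by (simp add: power2_eq_square algebra_simps)
  then have "pi * c * (of_int n ^ 2 / 2 - R ^ 2) \<le> pi * c * (of_int n + x) ^ 2"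
    using assms by (intro mult_left_mono) auto
  also have "\<dots> \<le> pi * Im \<tau> * (of_int n + x) ^ 2"
    using assms by (intro mult_right_mono mult_left_mono) auto
  finally show ?thesis
    unfolding norm_theta_term theta_bound_def by (simp add: algebra_simps flip: exp_add)
qed

lemma theta_uniform_limit_x:
  assumes "Im \<tau> > 0"
  shows "uniform_limit {-R..R} (\<lambda>X x. \<Sum>n\<in>X. theta_term x y \<tau> n) (\<lambda>x. theta x y \<tau>)
           (finite_subsets_at_top UNIV)"
  unfolding theta_def
  by (rule Weierstrass_m_test_general[where M = "theta_bound (Im \<tau>) R"])
     (use assms in \<open>auto intro!: norm_theta_term_le summable_theta_bound\<close>)

lemma continuous_on_theta_term [continuous_intros]:
  "continuous_on A (\<lambda>x. theta_term x y \<tau> n)"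
  unfolding theta_term_def by (intro continuous_intros)

lemma continuous_on_theta:
  assumes "Im \<tau> > 0" shows "continuous_on {0..1} (\<lambda>x. theta x y \<tau>)"
proof (rule uniform_limit_theorem)
  show "uniform_limit {0..1} (\<lambda>X x. \<Sum>n\<in>X. theta_term x y \<tau> n) (\<lambda>x. theta x y \<tau>)
           (finite_subsets_at_top UNIV)"
    by (rule uniform_limit_on_subset[OF theta_uniform_limit_x[OF assms, where R = 1]]) auto
qed (auto intro!: always_eventually continuous_intros)

lemma holomorphic_on_theta: "(\<lambda>\<tau>. theta x y \<tau>) holomorphic_on {\<tau>. Im \<tau> > 0}"
proof -
  have "(\<lambda>\<tau>. theta x y \<tau>) analytic_on {\<tau>}" if \<tau>: "Im \<tau> > 0" for \<tau>
  proof -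
    define r where "r = Im \<tau> / 2"
    have r: "r > 0" using \<tau> by (simp add: r_def)
    have *: "r \<le> Im w" if "w \<in> cball \<tau> r" for w
    proof -
      have "\<bar>Im (\<tau> - w)\<bar> \<le> r"
        using that abs_Im_le_cmod[of "\<tau> - w"] by (auto simp: dist_norm)
      then show ?thesis by (simp add: r_def abs_if split: if_splits)
    qed
    have "(\<lambda>\<tau>. theta x y \<tau>) holomorphic_on ball \<tau> r"
    proof (rule holomorphic_uniform_limit)
      show "uniform_limit (cball \<tau> r) (\<lambda>X \<tau>. \<Sum>n\<in>X. theta_term x y \<tau> n) (theta x y)
              (finite_subsets_at_top UNIV)"
        unfolding theta_def
        by (rule Weierstrass_m_test_general[where M = "theta_bound r \<bar>x\<bar>"])
           (use r * in \<open>auto intro!: norm_theta_term_le summable_theta_bound\<close>)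
      show "\<forall>\<^sub>F X in finite_subsets_at_top UNIV.
              continuous_on (cball \<tau> r) (\<lambda>\<tau>. \<Sum>n\<in>X. theta_term x y \<tau> n) \<and>
              (\<lambda>\<tau>. \<Sum>n\<in>X. theta_term x y \<tau> n) holomorphic_on ball \<tau> r"
        unfolding theta_term_def
        by (intro always_eventually allI conjI continuous_intros holomorphic_intros)
    qed auto
    then show ?thesis
      unfolding analytic_at using r by (intro exI[of _ "ball \<tau> r"]) auto
  qed
  then show ?thesis
    by (metis (mono_tags, lifting) analytic_imp_holomorphic analytic_on_analytic_at mem_Collect_eq)
qed

section \<open>Symmetries of theta in its characteristics and under T\<close>

lemma theta_neg: "theta (- x) (- y) \<tau> = theta x y \<tau>"
proof -
  have "theta x y \<tau> = (\<Sum>\<^sub>\<infinity>n. theta_term x y \<tau> (- n))"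
    unfolding theta_def by (rule infsum_reindex_bij_betw[symmetric]) (auto intro!: bij_uminus)
  also have "\<dots> = theta (- x) (- y) \<tau>"
    unfolding theta_def theta_term_def
    by (intro infsum_cong arg_cong[of _ _ exp]) (simp add: algebra_simps power2_eq_square)
  finally show ?thesis ..
qed

lemma theta_plus_int_left: "theta (x + of_int m) y \<tau> = theta x y \<tau>"
proof -
  have "theta x y \<tau> = (\<Sum>\<^sub>\<infinity>n. theta_term x y \<tau> (n + m))"
    unfolding theta_def by (rule infsum_reindex_bij_betw[symmetric]) (auto intro!: bij_plus_right)
  also have "\<dots> = theta (x + of_int m) y \<tau>"
    unfolding theta_def theta_term_def
    by (intro infsum_cong arg_cong[of _ _ exp]) (simp add: algebra_simps power2_eq_square)
  finally show ?thesis ..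
qed

lemma exp_pi_i_eqI:
  assumes "x = y + 2 * of_int k"
  shows "exp (pi * \<i> * x) = exp (pi * \<i> * y)"
  unfolding exp_eq assms by (rule exI[of _ k]) (simp add: algebra_simps)

definition exp_pii :: "real \<Rightarrow> complex" where
  "exp_pii x = exp (pi * \<i> * of_real x)"

lemma exp_pii_add: "exp_pii (x + y) = exp_pii x * exp_pii y"
  by (simp add: exp_pii_def exp_add distrib_left)

lemma exp_pii_eqI: "x = y + 2 * of_int k \<Longrightarrow> exp_pii x = exp_pii y"
  unfolding exp_pii_def by (rule exp_pi_i_eqI[where k = k]) simp

lemma exp_pii_1: "exp_pii 1 = - 1" and exp_pii_minus_half: "exp_pii (- 1/2) = - \<i>" and exp_pii_half: "exp_pii (1/2) = \<i>"
  using cis_pi_half cis_minus_pi_half by (simp_all add: exp_pii_def cis_conv_exp mult.commute)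

lemma theta_plus_int_right:
  "theta x (y + of_int m) \<tau> = exp_pii (2 * x * of_int m) * theta x y \<tau>"
proof -
  have "theta_term x (y + of_int m) \<tau> n =
    exp_pii (2 * x * of_int m) * theta_term x y \<tau> n" for n
    unfolding theta_term_def exp_pii_def exp_add[symmetric] distrib_left[symmetric]
    by (rule exp_pi_i_eqI[where k = "n * m"]) (simp add: algebra_simps)
  then show ?thesis
    unfolding theta_def infsum_cmult_right'[symmetric] by (rule infsum_cong)
qed

text \<open>The new factor has exponent (n + x)^2 = n (n - 1) + 2 (n + x)(x + 1/2) - x^2 - x. The
  even number n (n - 1) drops out, and the term linear in n + x becomes a shift of y.\<close>

lemma theta_plus_one:
  "theta x y (\<tau> + 1) = exp_pii (- (x ^ 2) - x) * theta x (y + x + 1/2) \<tau>"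
proof -
  have "theta_term x y (\<tau> + 1) n =
    exp_pii (- (x ^ 2) - x) * theta_term x (y + x + 1/2) \<tau> n" for n
  proof -
    have "even (n * (n - 1))" by simp
    then obtain k where "n * (n - 1) = 2 * k" by (rule dvdE)
    then have k: "of_int n * (of_int n - 1) = (2 * of_int k :: complex)"
      by (metis of_int_1 of_int_diff of_int_mult of_int_numeral)
    show ?thesis
      unfolding theta_term_def exp_pii_def exp_add[symmetric] distrib_left[symmetric]
      by (rule exp_pi_i_eqI[where k = k])
         (use k in \<open>simp add: algebra_simps power2_eq_square\<close>)
  qed
  then show ?thesis
    unfolding theta_def infsum_cmult_right'[symmetric] by (rule infsum_cong)
qed

section \<open>Uniqueness of Fourier coefficients\<close>

definition fourier_orth :: "(real \<Rightarrow> complex) \<Rightarrow> bool" where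
  "fourier_orth g \<longleftrightarrow> continuous_on {0..1} g \<and>
     (\<forall>k::int. ((\<lambda>x. g x * cis (2 * pi * of_int k * x)) has_integral 0) {0..1})"

text \<open>Since g is arbitrary, multipliers preserving orthogonality are closed under composition. This
  treats products of polynomials without an explicit trigonometric expansion.\<close>
lemma fourier_orth_mult_polynomial:
  assumes "real_polynomial_function p" "fourier_orth g"
  shows "fourier_orth (\<lambda>x. of_real (p (cis (2 * pi * x))) * g x)"
  using assms
proof (induction arbitrary: g rule: real_polynomial_function.induct)
  case (linear f)
  then interpret bounded_linear f by simp
  \<comment> \<open>On the unit circle a real-linear f is A z + B / z, so multiplication by f only
    shifts the frequency k by one in each direction.\<close>
  define A B where "A = (of_real (f 1) - \<i> * of_real (f \<i>)) / 2"
    and "B = (of_real (f 1) + \<i> * of_real (f \<i>)) / 2"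
  have f: "of_real (f (cis t)) = A * cis t + B * cis (- t)" for t
  proof -
    have "cis t = cos t *\<^sub>R 1 + sin t *\<^sub>R \<i>"
      by (simp add: complex_eq_iff)
    then have "f (cis t) = cos t * f 1 + sin t * f \<i>"
      by (metis add scaleR real_scaleR_def)
    then show ?thesis
      by (simp add: A_def B_def complex_eq_iff field_simps)
  qed
  have cont: "continuous_on {0..1} g"
    and int: "((\<lambda>x. g x * cis (2 * pi * of_int k * x)) has_integral 0) {0..1}" for k
    using linear.prems by (auto simp: fourier_orth_def)
  have "((\<lambda>x. of_real (f (cis (2 * pi * x))) * g x * cis (2 * pi * of_int k * x)) has_integral 0) {0..1}"
    for k
  proof -
    have "((\<lambda>x. A * (g x * cis (2 * pi * of_int (k + 1) * x)) +
                B * (g x * cis (2 * pi * of_int (k - 1) * x))) has_integral A * 0 + B * 0) {0..1}"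
      by (intro has_integral_add has_integral_mult_right int)
    also have "(\<lambda>x. A * (g x * cis (2 * pi * of_int (k + 1) * x)) +
                B * (g x * cis (2 * pi * of_int (k - 1) * x))) =
      (\<lambda>x. of_real (f (cis (2 * pi * x))) * g x * cis (2 * pi * of_int k * x))"
    proof
      fix x
      have "cis (2 * pi * of_int (k + 1) * x) = cis (2 * pi * x) * cis (2 * pi * of_int k * x)"
           "cis (2 * pi * of_int (k - 1) * x) = cis (- (2 * pi * x)) * cis (2 * pi * of_int k * x)"
        by (simp_all add: cis_mult algebra_simps)
      then show "A * (g x * cis (2 * pi * of_int (k + 1) * x)) +
                B * (g x * cis (2 * pi * of_int (k - 1) * x)) =
        of_real (f (cis (2 * pi * x))) * g x * cis (2 * pi * of_int k * x)"
        unfolding f by (simp only: ring_distribs ac_simps)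
    qed
    finally show ?thesis by simp
  qed
  moreover have "continuous_on {0..1} (\<lambda>x. of_real (f (cis (2 * pi * x))) * g x)"
    unfolding f by (intro continuous_intros cont)
  ultimately show ?case by (simp add: fourier_orth_def)
next
  case (const c)
  have "((\<lambda>x. of_real c * (g x * cis (2 * pi * of_int k * x))) has_integral of_real c * 0) {0..1}" for k
    using const.prems by (intro has_integral_mult_right) (auto simp: fourier_orth_def)
  then show ?case
    using const.prems unfolding fourier_orth_def
    by (auto intro!: continuous_intros simp: mult.assoc)
next
  case (add f f')
  note IH = add.IH[OF add.prems, unfolded fourier_orth_def]
  show ?case
    unfolding fourier_orth_def of_real_add distrib_right
    using has_integral_add[OF spec[OF conjunct2[OF IH(1)]] spec[OF conjunct2[OF IH(2)]]]
    by (auto intro!: continuous_on_add conjunct1[OF IH(1)] conjunct1[OF IH(2)])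
next
  case (mult f f')
  show ?case
    using mult.IH(1)[OF mult.IH(2)[OF mult.prems]] by (simp add: mult.assoc)
qed

text \<open>A loop is homotopic to itself. Transferring this trivial homotopy to circle maps yields
  continuity of the induced map, including at the point 1 where \<open>Arg2pi\<close> jumps.\<close>

lemma continuous_on_circle_of_loop:
  assumes "continuous_on {0..1} h" "h 0 = h (1::real)"
  shows "continuous_on (sphere 0 1) (\<lambda>z. h (Arg2pi z / (2 * pi)))"
proof -
  have "homotopic_loops (h ` {0..1}) h h"
    unfolding homotopic_loops_refl using assms
    by (auto simp: path_def path_image_def pathstart_def pathfinish_def)
  from homotopic_loops_imp_homotopic_circlemaps[OF this]
  show ?thesis
    by (metis (no_types, lifting) homotopic_with_imp_continuous comp_def continuous_on_cong)
qed

text \<open>The conjugate of h is a continuous function on the circle, hence a uniform limit of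
  polynomials g by Stone-Weierstrass. The integral of g h vanishes for each of them, so the integral
  of |h|^2 is 0, and continuity forces h = 0.\<close>

theorem fourier_orth_loop_eq_0:
  assumes orth: "fourier_orth h" and loop: "h 0 = h 1" and x: "x \<in> {0..1}"
  shows "h x = 0"
proof -
  have cont: "continuous_on {0..1} h"
    using orth by (simp add: fourier_orth_def)
  define q where "q z = cnj (h (Arg2pi z / (2 * pi)))" for z
  have q: "q (cis (2 * pi * t)) = cnj (h t)" if "t \<in> {0..1}" for t
  proof (cases "t = 1")
    case True
    \<comment> \<open>\<open>Arg2pi\<close> takes values in [0, 2 pi), so at t = 1 the function
      \<open>q\<close> reads off h 0; the loop condition identifies it with h 1.\<close>
    have "Arg2pi 1 = 0" using Arg2pi_unique[of 1 0 1] by simp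
    then show ?thesis using True loop by (simp add: q_def)
  next
    case False
    then have "Arg2pi (cis (2 * pi * t)) = 2 * pi * t"
      using that by (intro Arg2pi_unique[of 1]) (auto simp: cis_conv_exp)
    then show ?thesis by (simp add: q_def)
  qed
  have contq: "continuous_on (sphere 0 1) q"
    unfolding q_def by (intro continuous_intros continuous_on_circle_of_loop cont loop)
  obtain C where C: "C > 0" "\<And>t. t \<in> {0..1} \<Longrightarrow> norm (h t) \<le> C"
  proof -
    have "bounded (h ` {0..1})"
      by (intro compact_imp_bounded compact_continuous_image cont) auto
    then show ?thesis using that unfolding bounded_pos by auto
  qed
  have "(\<lambda>t. cnj (h t) * h t) integrable_on {0..1}"
    by (intro integrable_continuous_real continuous_intros cont)
  then obtain J where J: "((\<lambda>t. cnj (h t) * h t) has_integral J) {0..1}"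
    by blast
  have "norm J \<le> e" if "e > 0" for e
  proof -
    \<comment> \<open>The tolerance e / C becomes an error of at most e after multiplication by h,
      which is bounded by C.\<close>
    obtain g where g: "polynomial_function g" "\<And>z. z \<in> sphere 0 1 \<Longrightarrow> norm (q z - g z) < e / C"
      using Stone_Weierstrass_polynomial_function[OF compact_sphere contq, of "e / C"] C \<open>e > 0\<close> by auto
    have re: "real_polynomial_function (Re \<circ> g)" and im: "real_polynomial_function (Im \<circ> g)"
      using g(1) bounded_linear_Re bounded_linear_Im unfolding polynomial_function_def by blast+
    have "((\<lambda>t. of_real (Re (g (cis (2 * pi * t)))) * h t) has_integral 0) {0..1}"
         "((\<lambda>t. of_real (Im (g (cis (2 * pi * t)))) * h t) has_integral 0) {0..1}"
      using fourier_orth_mult_polynomial[OF re orth] fourier_orth_mult_polynomial[OF im orth]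
      unfolding fourier_orth_def by (auto dest!: spec[of _ 0])
    then have "((\<lambda>t. of_real (Re (g (cis (2 * pi * t)))) * h t +
       \<i> * (of_real (Im (g (cis (2 * pi * t)))) * h t)) has_integral 0 + \<i> * 0) {0..1}"
      by (intro has_integral_add has_integral_mult_right)
    also have "(\<lambda>t. of_real (Re (g (cis (2 * pi * t)))) * h t +
       \<i> * (of_real (Im (g (cis (2 * pi * t)))) * h t)) = (\<lambda>t. g (cis (2 * pi * t)) * h t)"
      by (simp add: fun_eq_iff complex_eq_iff)
    finally have "((\<lambda>t. cnj (h t) * h t - g (cis (2 * pi * t)) * h t) has_integral J - 0) {0..1}"
      by (intro has_integral_diff J) simp
    moreover have "norm (cnj (h t) * h t - g (cis (2 * pi * t)) * h t) \<le> e" if "t \<in> {0..1}" for t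
    proof -
      have "norm (cnj (h t) * h t - g (cis (2 * pi * t)) * h t) =
        norm (q (cis (2 * pi * t)) - g (cis (2 * pi * t))) * norm (h t)"
        unfolding q[OF that] norm_mult[symmetric] by (simp add: algebra_simps)
      also have "\<dots> \<le> e / C * C"
        using g(2)[of "cis (2 * pi * t)"] C that \<open>e > 0\<close> by (intro mult_mono) (auto intro: less_imp_le)
      finally show ?thesis using C by simp
    qed
    ultimately have "norm (J - 0) \<le> e * measure lborel {0..1::real}"
      by (intro has_integral_bound_real) (use \<open>e > 0\<close> in auto)
    then show ?thesis by simp
  qed
  then have "J = 0"
    by (metis dense_ge norm_le_zero_iff)
  then have "((\<lambda>t. Re (cnj (h t) * h t)) has_integral Re 0) {0..1}"
    using J by (intro has_integral_Re) simp
  also have "(\<lambda>t. Re (cnj (h t) * h t)) = (\<lambda>t. norm (h t) ^ 2)"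
    by (simp add: cmod_power2) (simp add: power2_eq_square)
  finally have "((\<lambda>t. norm (h t) ^ 2) has_integral 0) {0..1}" by simp
  moreover have "continuous_on {0..1} (\<lambda>t. norm (h t) ^ 2)"
    by (intro continuous_intros cont)
  ultimately have "norm (h x) ^ 2 = 0"
    using has_integral_0_cbox_imp_0[of 0 1 "\<lambda>t. norm (h t) ^ 2" x] x by simp
  then show ?thesis by simp
qed

section \<open>Poisson summation\<close>

text \<open>This is the characteristic function of the standard normal law after the substitution x
  = c u: c^2 = 2 pi s turns x^2/2 into pi s u^2, and t c = 2 pi w matches the frequencies.\<close>

lemma gaussian_fourier_transform:
  fixes s w :: real
  assumes s: "s > 0"
  defines "G \<equiv> \<lambda>u. of_real (exp (- pi * s * u ^ 2)) * cis (2 * pi * w * u)"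
  shows "integrable lborel G"
    and "integral\<^sup>L lborel G = of_real (exp (- pi * w ^ 2 / s) / sqrt s)"
proof -
  define c where "c = sqrt (2 * pi * s)"
  have c: "c > 0" "c ^ 2 = 2 * pi * s" using s by (simp_all add: c_def)
  define t where "t = 2 * pi * w / c"
  define g where "g x = std_normal_density x *\<^sub>R iexp (t * x)" for x
  have meas [measurable]: "(\<lambda>x. iexp (t * x)) \<in> borel_measurable borel"
    by (intro borel_measurable_continuous_onI continuous_intros)
  have "integrable lborel std_normal_density" by simp
  then have int: "integrable lborel g"
    unfolding g_def
    by (rule Bochner_Integration.integrable_bound) (auto simp: norm_exp_eq_Re)
  have "integral\<^sup>L lborel g = char std_normal_distribution t"
    unfolding char_def g_def by (subst integral_density) auto
  then have val: "integral\<^sup>L lborel g = of_real (exp (- (t ^ 2) / 2))"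
    by (simp add: char_std_normal_distribution)
  have G: "G = (\<lambda>u. of_real (sqrt (2 * pi)) * g (0 + c * u))"
  proof
    fix u
    have 1: "t * (c * u) = 2 * pi * w * u" and 2: "- ((c * u) ^ 2) / 2 = - pi * s * u ^ 2"
      using c by (simp_all add: t_def power_mult_distrib)
    show "G u = of_real (sqrt (2 * pi)) * g (0 + c * u)"
      unfolding G_def g_def std_normal_density_def add_0 1 2
      by (simp add: cis_conv_exp scaleR_conv_of_real)
  qed
  show "integrable lborel G"
    unfolding G using c int by (intro integrable_mult_right lborel_integrable_real_affine) auto
  have "of_real (sqrt (2 * pi)) * integral\<^sup>L lborel g = c * integral\<^sup>L lborel G"
    unfolding G using lborel_integral_real_affine[of c g 0] c
    by (simp add: scaleR_conv_of_real)
  moreover have "t ^ 2 / 2 = pi * w ^ 2 / s"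
    using c s by (simp add: t_def power_divide power_mult_distrib power2_eq_square)
  ultimately have *: "of_real (sqrt (2 * pi)) * of_real (exp (- pi * w ^ 2 / s)) = of_real c * integral\<^sup>L lborel G"
    unfolding val by simp
  have "c = sqrt (2 * pi) * sqrt s" by (simp add: c_def real_sqrt_mult)
  then have "of_real (exp (- pi * w ^ 2 / s)) = of_real (sqrt s) * integral\<^sup>L lborel G"
    using * by (simp del: of_real_exp)
  then show "integral\<^sup>L lborel G = of_real (exp (- pi * w ^ 2 / s) / sqrt s)"
    using s by (simp add: field_simps del: of_real_exp)
qed

lemma integral_symmetric_interval_tendsto:
  fixes G :: "real \<Rightarrow> complex"
  assumes G: "integrable lborel G"
  shows "(\<lambda>N. integral {- real N..real N} G) \<longlonglongrightarrow> integral\<^sup>L lborel G"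
proof -
  have [measurable]: "G \<in> borel_measurable borel" using G by auto
  have "(\<lambda>N. LINT u|lborel. indicator {- real N..real N} u *\<^sub>R G u) \<longlonglongrightarrow> integral\<^sup>L lborel G"
  proof (rule integral_dominated_convergence)
    show "AE u in lborel. (\<lambda>N. indicator {- real N..real N} u *\<^sub>R G u) \<longlonglongrightarrow> G u"
    proof (rule AE_I2)
      fix u :: real
      have "\<forall>\<^sub>F N in sequentially. indicator {- real N..real N} u *\<^sub>R G u = G u"
        using eventually_ge_at_top[of "nat \<lceil>\<bar>u\<bar>\<rceil>"]
        by eventually_elim (auto simp: indicator_def abs_le_iff)
      then show "(\<lambda>N. indicator {- real N..real N} u *\<^sub>R G u) \<longlonglongrightarrow> G u"
        by (rule tendsto_eventually)
    qed
    show "integrable lborel (\<lambda>u. norm (G u))" using G by simp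
  qed (auto simp: indicator_def)
  moreover have "(LINT u|lborel. indicator {- real N..real N} u *\<^sub>R G u) = integral {- real N..real N} G" for N
  proof -
    have "set_integrable lborel {- real N..real N} G"
      using G unfolding set_integrable_def by (intro integrable_mult_indicator) auto
    then show ?thesis
      using set_borel_integral_eq_integral(2)[of "{- real N..real N}" G]
      by (simp add: set_lebesgue_integral_def)
  qed
  ultimately show ?thesis by simp
qed

lemma sum_integral_unit_intervals:
  fixes G :: "real \<Rightarrow> complex"
  assumes cont: "continuous_on UNIV G"
  shows "(\<Sum>n\<in>{- int N..<int N}. integral {0..1} (\<lambda>x. G (of_int n + x))) = integral {- real N..real N} G"
proof (induction N)
  case (Suc N)
  have int: "G integrable_on {a..b}" for a b
    by (intro integrable_continuous_real continuous_on_subset[OF cont]) auto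
  have shift: "integral {0..1} (\<lambda>x. G (of_int n + x)) = integral {of_int n..of_int n + 1} G" for n :: int
    using integral_shift_Icc_real[of 0 1 G "of_int n"] by (simp add: o_def add.commute)
  \<comment> \<open>Index n stands for the interval [n, n + 1], so the half-open index range fills
    exactly [-N, N]; the step adds one interval at each end.\<close>
  have "{- int (Suc N)..<int (Suc N)} = insert (int N) (insert (- int N - 1) {- int N..<int N})"
    by auto
  then have "(\<Sum>n\<in>{- int (Suc N)..<int (Suc N)}. integral {0..1} (\<lambda>x. G (of_int n + x))) =
     integral {real N..real N + 1} G + (integral {- real N - 1..- real N} G + integral {- real N..real N} G)"
    using Suc.IH unfolding shift by simp
  also have "integral {- real N - 1..- real N} G + integral {- real N..real N} G = integral {- real N - 1..real N} G"
    by (intro Henstock_Kurzweil_Integration.integral_combine int) auto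
  also have "integral {real N..real N + 1} G + \<dots> = integral {- real N - 1..real N + 1} G"
    using Henstock_Kurzweil_Integration.integral_combine[of "- real N - 1" "real N" "real N + 1" G] int
    by (simp add: add.commute)
  also have "{- real N - 1..real N + 1} = {- real (Suc N)..real (Suc N)}" by auto
  finally show ?case .
qed auto

text \<open>Unfolding: since k n is an integer, x may be replaced by n + x in the factor cis(-2 pi k
  x). The integrand is then the sum of the translates G(n + x), and their integrals over the unit
  interval assemble to the integral of G over the line.\<close>

lemma theta_fourier_coefficient:
  fixes k :: int
  assumes s: "s > 0"
  shows "((\<lambda>x. theta x y (\<i> * of_real s) * cis (- (2 * pi * of_int k * x))) has_integral
           of_real (exp (- pi * (y - of_int k) ^ 2 / s) / sqrt s)) {0..1}"
proof -
  define G where "G u = of_real (exp (- pi * s * u ^ 2)) * cis (2 * pi * (y - of_int k) * u)" for u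
  define f where "f n x = theta_term x y (\<i> * of_real s) n * cis (- (2 * pi * of_int k * x))" for n x
  have f: "f n x = G (of_int n + x)" for n x
  proof -
    have "theta_term x y (\<i> * of_real s) n =
      of_real (exp (- pi * s * (of_int n + x) ^ 2)) * cis (2 * pi * y * (of_int n + x))"
      unfolding theta_term_def cis_conv_exp exp_of_real[symmetric] exp_add[symmetric]
      by (intro arg_cong[of _ _ exp]) (simp add: algebra_simps)
    moreover have "cis (2 * pi * y * (of_int n + x)) * cis (- (2 * pi * of_int k * x)) =
       cis (2 * pi * (y - of_int k) * (of_int n + x))"
    proof -
      have "cis (2 * pi * (y - of_int k) * (of_int n + x)) =
        cis (2 * pi * y * (of_int n + x)) * cis (- (2 * pi * of_int k * x)) * cis (2 * pi * of_int (- k * n))"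
        by (simp add: cis_mult algebra_simps)
      also have "cis (2 * pi * of_int (- k * n)) = 1"
        by (rule cis_multiple_2pi) auto
      finally show ?thesis by simp
    qed
    ultimately show ?thesis by (simp add: f_def G_def mult.assoc)
  qed
  have "uniform_limit {0..1} (\<lambda>X x. \<Sum>n\<in>X. f n x) (\<lambda>x. \<Sum>\<^sub>\<infinity>n. f n x) (finite_subsets_at_top UNIV)"
    by (rule Weierstrass_m_test_general[where M = "theta_bound s 1"])
       (use s in \<open>auto simp: f_def norm_mult intro!: norm_theta_term_le summable_theta_bound\<close>)
  \<comment> \<open>Convergence along all finite index sets is specialised to symmetric ranges, over
    which the unit intervals join to [-N, N].\<close>
  moreover have "filterlim (\<lambda>N. {- int N..<int N}) (finite_subsets_at_top UNIV) sequentially"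
    unfolding filterlim_finite_subsets_at_top
  proof (intro allI impI)
    fix X :: "int set" assume X: "finite X \<and> X \<subseteq> UNIV"
    define m where "m = Max (insert 0 (abs ` X))"
    have m: "\<bar>x\<bar> \<le> m" if "x \<in> X" for x
      using X that unfolding m_def by (intro Max_ge) auto
    show "\<forall>\<^sub>F N in sequentially. finite {- int N..<int N} \<and> X \<subseteq> {- int N..<int N} \<and> {- int N..<int N} \<subseteq> UNIV"
      using eventually_gt_at_top[of "nat m"]
    proof eventually_elim
      case (elim N)
      then show ?case using m by (fastforce simp: abs_le_iff)
    qed
  qed
  ultimately have ulim: "uniform_limit {0..1} (\<lambda>N x. \<Sum>n\<in>{- int N..<int N}. f n x) (\<lambda>x. \<Sum>\<^sub>\<infinity>n. f n x) sequentially"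
    by (rule filterlim_compose)
  have cont: "continuous_on A G" for A
    unfolding G_def by (intro continuous_intros)
  have contf: "continuous_on A (f n)" for A n
    unfolding f_def theta_term_def by (intro continuous_intros)
  obtain I J where I: "\<And>N. ((\<lambda>x. \<Sum>n\<in>{- int N..<int N}. f n x) has_integral I N) {0..1}"
      and J: "((\<lambda>x. \<Sum>\<^sub>\<infinity>n. f n x) has_integral J) {0..1}" and lim: "I \<longlonglongrightarrow> J"
    by (rule uniform_limit_integral[OF ulim]) (auto intro!: continuous_on_sum contf)
  have "I N = integral {- real N..real N} G" for N
  proof -
    have "f n integrable_on {0..1}" for n
      by (intro integrable_continuous_real contf)
    then have "I N = (\<Sum>n\<in>{- int N..<int N}. integral {0..1} (f n))"
      using integral_unique[OF I[of N]] by (simp add: Henstock_Kurzweil_Integration.integral_sum)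
    then show ?thesis
      using sum_integral_unit_intervals[OF cont, of N] by (simp add: f[abs_def])
  qed
  moreover have "integrable lborel G"
    and valG: "integral\<^sup>L lborel G = of_real (exp (- pi * (y - of_int k) ^ 2 / s) / sqrt s)"
    unfolding G_def[abs_def] by (rule gaussian_fourier_transform[OF s])+
  ultimately have "I \<longlonglongrightarrow> integral\<^sup>L lborel G"
    using integral_symmetric_interval_tendsto[of G] by presburger
  then have "J = of_real (exp (- pi * (y - of_int k) ^ 2 / s) / sqrt s)"
    using LIMSEQ_unique[OF lim] valG by metis
  moreover have "(\<Sum>\<^sub>\<infinity>n. f n x) = theta x y (\<i> * of_real s) * cis (- (2 * pi * of_int k * x))" for x
    unfolding f_def theta_def by (rule infsum_cmult_left')
  ultimately show ?thesis using J by simp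
qed

text \<open>\<open>R\<close> is the right-hand side written as a Fourier series in x. Theta and
  \<open>R\<close> are continuous on [0, 1], have period 1 in x, and share the coefficients
  \<open>a k\<close>. Uniqueness gives equality on [0, 1], and periodicity extends it to all
  x.\<close>

theorem theta_poisson:
  assumes s: "s > 0"
  shows "theta x y (\<i> * of_real s) =
    exp_pii (2 * x * y) / of_real (sqrt s) * theta y (- x) (\<i> * of_real (1 / s))"
proof -
  define a where "a n = exp (- pi * (y - of_int n) ^ 2 / s) / sqrt s" for n :: int
  define R where "R x = (\<Sum>\<^sub>\<infinity>n. of_real (a n) * cis (2 * pi * of_int n * x))" for x
  have summ: "(\<lambda>n. theta_bound (1 / s) \<bar>y\<bar> n / sqrt s) summable_on UNIV"
    using summable_theta_bound[of "1 / s"] s unfolding divide_inverse by (intro summable_on_cmult_left) simp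
  have a: "a n \<le> theta_bound (1 / s) \<bar>y\<bar> n / sqrt s" "a n \<ge> 0" for n
  proof -
    \<comment> \<open>Up to the factor 1 / sqrt s, \<open>a n\<close> is the norm of a theta term at
      i / s, so the same majorant serves again.\<close>
    have "exp (- pi * (y - of_int n) ^ 2 / s) \<le> theta_bound (1 / s) \<bar>y\<bar> n"
      using norm_theta_term_le[of "- y" "\<bar>y\<bar>" "1 / s" "\<i> * of_real (1 / s)" 0 n] s
      by (simp add: norm_theta_term power2_commute)
    then show "a n \<le> theta_bound (1 / s) \<bar>y\<bar> n / sqrt s"
      using s unfolding a_def by (intro divide_right_mono) auto
    show "a n \<ge> 0" using s by (simp add: a_def)
  qed
  \<comment> \<open>Carrying the factor with k along lets one uniform limit give both the continuity
    of \<open>R\<close> (k = 0) and its Fourier coefficients.\<close>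
  have ulim: "uniform_limit {0..1}
      (\<lambda>X x. \<Sum>n\<in>X. of_real (a n) * cis (2 * pi * of_int n * x) * cis (- (2 * pi * of_int k * x)))
      (\<lambda>x. R x * cis (- (2 * pi * of_int k * x))) (finite_subsets_at_top UNIV)" for k :: int
    unfolding R_def infsum_cmult_left'[symmetric]
    by (rule Weierstrass_m_test_general[OF _ summ]) (use a in \<open>simp add: norm_mult\<close>)
  have contR: "continuous_on {0..1} R"
    by (rule uniform_limit_theorem[OF _ ulim[of 0, simplified]])
       (auto intro!: always_eventually continuous_intros)
  have coeffR: "((\<lambda>x. R x * cis (- (2 * pi * of_int k * x))) has_integral of_real (a k)) {0..1}" for k
  proof -
    define f where "f n x = of_real (a n) * cis (2 * pi * of_int n * x) * cis (- (2 * pi * of_int k * x))" for n x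
    have f: "(f n has_integral (if n = k then of_real (a k) else 0)) {0..1}" for n
    proof (cases "n = k")
      case True
      have "((\<lambda>x. of_real (a k)) has_integral (1 - 0) *\<^sub>R complex_of_real (a k)) {0..1::real}"
        using has_integral_const_real[of "complex_of_real (a k)" 0 1] by simp
      then show ?thesis using True by (simp add: f_def[abs_def] cis_mult mult.assoc)
    next
      case False
      define w where "w = 2 * pi * of_int (n - k)"
      have w: "w \<noteq> 0" using False by (simp add: w_def)
      define F where "F x = of_real (a n) / (\<i> * of_real w) * cis (w * x)" for x
      have "(f n has_integral (F 1 - F 0)) {0..1}"
      proof (rule fundamental_theorem_of_calculus)
        fix x :: real
        have "((\<lambda>z. of_real (a n) / (\<i> * of_real w) * exp (\<i> * of_real w * z)) has_field_derivative
            of_real (a n) * exp (\<i> * of_real w * of_real x)) (at (of_real x))"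
          by (rule derivative_eq_intros refl)+ (use w in simp)
        from has_vector_derivative_real_field[OF this]
        have "(F has_vector_derivative of_real (a n) * exp (\<i> * of_real w * of_real x)) (at x within {0..1})"
          by (simp add: F_def[abs_def] cis_conv_exp mult.assoc)
        also have "of_real (a n) * exp (\<i> * of_real w * of_real x) = of_real (a n) * cis (w * x)"
          by (simp add: cis_conv_exp mult.assoc)
        also have "\<dots> = f n x"
          by (simp add: f_def w_def cis_mult algebra_simps)
        finally show "(F has_vector_derivative f n x) (at x within {0..1})" .
      qed simp
      also have "cis w = 1"
        unfolding w_def by (rule cis_multiple_2pi) auto
      then have "F 1 - F 0 = 0" by (simp add: F_def)
      finally show ?thesis using False by simp
    qed
    obtain I J where I: "\<And>X. ((\<lambda>x. \<Sum>n\<in>X. f n x) has_integral I X) {0..1}"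
      and J: "((\<lambda>x. R x * cis (- (2 * pi * of_int k * x))) has_integral J) {0..1}"
      and lim: "(I \<longlongrightarrow> J) (finite_subsets_at_top UNIV)"
      by (rule uniform_limit_integral[OF ulim[of k, folded f_def]])
         (auto intro!: continuous_intros simp: f_def)
    have "I X = of_real (a k)" if "finite X" "k \<in> X" for X
    proof -
      have "((\<lambda>x. \<Sum>n\<in>X. f n x) has_integral (\<Sum>n\<in>X. if n = k then of_real (a k) else 0)) {0..1}"
        by (intro has_integral_sum f that)
      then show ?thesis
        using that has_integral_unique[OF I[of X]] by simp
    qed
    moreover have "\<forall>\<^sub>F X in finite_subsets_at_top UNIV. finite X \<and> {k} \<subseteq> X \<and> X \<subseteq> UNIV"
      unfolding eventually_finite_subsets_at_top by (rule exI[of _ "{k}"]) auto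
    ultimately have "(I \<longlongrightarrow> of_real (a k)) (finite_subsets_at_top UNIV)"
      by (intro tendsto_eventually) (auto elim!: eventually_mono)
    then have "J = of_real (a k)"
      using lim by (intro tendsto_unique[OF _ lim]) auto
    then show ?thesis using J by simp
  qed
  define \<theta> where "\<theta> x = theta x y (\<i> * of_real s)" for x
  have "fourier_orth (\<lambda>x. \<theta> x - R x)"
    unfolding fourier_orth_def
  proof (intro conjI allI)
    show "continuous_on {0..1} (\<lambda>x. \<theta> x - R x)"
      unfolding \<theta>_def using s by (intro continuous_intros continuous_on_theta contR) auto
    fix k :: int
    \<comment> \<open>\<open>fourier_orth\<close> tests against cis(2 pi k x), the coefficients
      against cis(-2 pi k x); hence the index -k.\<close>
    have "((\<lambda>x. \<theta> x * cis (- (2 * pi * of_int (- k) * x)) - R x * cis (- (2 * pi * of_int (- k) * x)))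
       has_integral of_real (a (- k)) - of_real (a (- k))) {0..1}"
      unfolding \<theta>_def a_def[of "- k"]
      by (intro has_integral_diff theta_fourier_coefficient s coeffR[of "- k", unfolded a_def[of "- k"]])
    then show "((\<lambda>x. (\<theta> x - R x) * cis (2 * pi * of_int k * x)) has_integral 0) {0..1}"
      by (simp add: left_diff_distrib)
  qed
  moreover have per\<theta>: "\<theta> (x + of_int m) = \<theta> x" for x m
    unfolding \<theta>_def by (rule theta_plus_int_left)
  moreover have perR: "R (x + of_int m) = R x" for x m
    unfolding R_def
  proof (intro infsum_cong)
    fix n
    have "cis (2 * pi * of_int n * (x + of_int m)) = cis (2 * pi * of_int n * x) * cis (2 * pi * of_int (n * m))"
      by (simp add: cis_mult algebra_simps)
    also have "cis (2 * pi * of_int (n * m)) = 1"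
      by (rule cis_multiple_2pi) auto
    finally show "of_real (a n) * cis (2 * pi * of_int n * (x + of_int m)) = of_real (a n) * cis (2 * pi * of_int n * x)"
      by simp
  qed
  ultimately have eq: "\<theta> x - R x = 0" if "x \<in> {0..1}" for x
    using that per\<theta>[of 0 1] perR[of 0 1] by (intro fourier_orth_loop_eq_0[of "\<lambda>x. \<theta> x - R x"]) auto
  have "\<theta> x = R x"
    using eq[of "frac x"] per\<theta>[of "frac x" "\<lfloor>x\<rfloor>"] perR[of "frac x" "\<lfloor>x\<rfloor>"] frac_lt_1[of x]
    by (simp add: frac_def)
  also have "R x = exp_pii (2 * x * y) / of_real (sqrt s) *
      (\<Sum>\<^sub>\<infinity>n. theta_term (- y) x (\<i> * of_real (1 / s)) n)"
    unfolding R_def infsum_cmult_right'[symmetric]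
  proof (rule infsum_cong)
    fix n
    have "of_real (exp (- pi * (y - of_int n) ^ 2 / s)) * cis (2 * pi * of_int n * x) =
      exp_pii (2 * x * y) * theta_term (- y) x (\<i> * of_real (1 / s)) n"
      unfolding theta_term_def exp_pii_def cis_conv_exp exp_of_real[symmetric] exp_add[symmetric]
      by (intro arg_cong[of _ _ exp]) (simp add: field_simps power2_eq_square)
    then show "of_real (a n) * cis (2 * pi * of_int n * x) =
      exp_pii (2 * x * y) / of_real (sqrt s) * theta_term (- y) x (\<i> * of_real (1 / s)) n"
      by (simp add: a_def)
  qed
  also have "(\<Sum>\<^sub>\<infinity>n. theta_term (- y) x (\<i> * of_real (1 / s)) n) = theta y (- x) (\<i> * of_real (1 / s))"
    using theta_neg[of y "- x"] by (simp add: theta_def)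
  finally show ?thesis by (simp add: \<theta>_def)
qed

text \<open>Both sides are holomorphic on the half plane, since -i tau has positive real part and
  avoids the cut of \<open>csqrt\<close>. On tau = i t the claim is \<open>theta_poisson\<close>
  with s = 1/t, and these points accumulate at i.\<close>

theorem theta_minus_inverse:
  assumes \<tau>: "Im \<tau> > 0"
  shows "theta x y (- 1 / \<tau>) = csqrt (- \<i> * \<tau>) * exp_pii (2 * x * y) * theta y (- x) \<tau>"
proof -
  define f where "f \<tau> = theta x y (- 1 / \<tau>) -
    csqrt (- \<i> * \<tau>) * exp_pii (2 * x * y) * theta y (- x) \<tau>" for \<tau>
  have hol1: "(\<lambda>\<tau>. theta x y (- 1 / \<tau>)) holomorphic_on {\<tau>. Im \<tau> > 0}"
  proof -
    have "(\<lambda>\<tau>. - 1 / \<tau>) holomorphic_on {\<tau>. Im \<tau> > 0}"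
      by (intro holomorphic_intros) auto
    moreover have "(\<lambda>\<tau>. - 1 / \<tau>) ` {\<tau>. Im \<tau> > 0} \<subseteq> {\<tau>. Im \<tau> > 0}"
      by (auto simp: Im_divide intro!: divide_pos_pos sum_power2_gt_zero_iff[THEN iffD2])
    ultimately show ?thesis
      using holomorphic_on_compose_gen[OF _ holomorphic_on_theta] by (simp add: o_def)
  qed
  have "f \<tau> = 0"
  proof (rule analytic_continuation[of f])
    show "f holomorphic_on {\<tau>. Im \<tau> > 0}"
      unfolding f_def
      by (intro holomorphic_intros hol1 holomorphic_on_theta) (auto simp: complex_nonpos_Reals_iff)
    show "open {\<tau>. Im \<tau> > 0}" by (rule open_halfspace_Im_gt)
    show "connected {\<tau>. Im \<tau> > 0}" by (intro convex_connected convex_halfspace_Im_gt)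
    show "(\<lambda>t. \<i> * of_real t) ` {0<..} \<subseteq> {\<tau>. Im \<tau> > 0}" "\<i> \<in> {\<tau>. Im \<tau> > 0}" by auto
    show "\<i> islimpt (\<lambda>t. \<i> * of_real t) ` {0<..}"
      unfolding islimpt_approachable
    proof (intro allI impI)
      fix e :: real assume "e > 0"
      then show "\<exists>z\<in>(\<lambda>t. \<i> * of_real t) ` {0<..}. z \<noteq> \<i> \<and> dist z \<i> < e"
        by (intro bexI[of _ "\<i> * of_real (1 + e / 2)"])
           (auto simp: dist_norm norm_mult algebra_simps complex_eq_iff)
    qed
    show "f z = 0" if z: "z \<in> (\<lambda>t. \<i> * of_real t) ` {0<..}" for z
    proof -
      obtain t where t: "t > 0" "z = \<i> * of_real t" using z by auto
      have "csqrt (- \<i> * z) = of_real (sqrt t)"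
        using t by simp
      moreover have "- 1 / z = \<i> * of_real (1 / t)"
        using t by (simp add: field_simps)
      ultimately show ?thesis
        using theta_poisson[of "1 / t" x y] t by (simp add: f_def real_sqrt_divide)
    qed
  qed (use \<tau> in auto)
  then show ?thesis by (simp add: f_def)
qed

section \<open>Klein forms\<close>

text \<open>With z = p tau + r this equals exp(pi i p z) times the odd theta function at z, the sum
  of exp(pi i (n + 1/2)^2 tau + 2 pi i (n + 1/2)(z + 1/2)). This choice of phase makes the factors
  in the T- and S-rules independent of p and r.\<close>

definition klein :: "real \<Rightarrow> real \<Rightarrow> complex \<Rightarrow> complex" where
  "klein p r \<tau> = exp_pii (- p * (r + 1)) * theta (1/2 + p) (1/2 + r) \<tau>"

lemma klein_plus_one: "klein p r (\<tau> + 1) = exp_pii (1/4) * klein p (p + r) \<tau>"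
proof -
  \<comment> \<open>The halves add up to 1/2 + (p + r) + 1; the surplus unit is traded for a
    phase.\<close>
  have "theta (1/2 + p) (1/2 + r + (1/2 + p) + 1/2) \<tau> =
      exp_pii (2 * (1/2 + p) * of_int 1) * theta (1/2 + p) (1/2 + (p + r)) \<tau>"
    by (subst theta_plus_int_right[symmetric]) (simp add: algebra_simps)
  then have "klein p r (\<tau> + 1) = exp_pii (- p * (r + 1) + (- ((1/2 + p) ^ 2) - (1/2 + p)) +
      2 * (1/2 + p) * of_int 1) * theta (1/2 + p) (1/2 + (p + r)) \<tau>"
    unfolding klein_def theta_plus_one by (simp only: exp_pii_add mult.assoc)
  also have "\<dots> = exp_pii (1/4 + (- p * (p + r + 1))) * theta (1/2 + p) (1/2 + (p + r)) \<tau>"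
    by (intro arg_cong2[of _ _ _ _ "(*)"] arg_cong[of _ _ exp_pii]) (simp_all add: field_simps power2_eq_square)
  finally show ?thesis
    unfolding klein_def by (simp only: exp_pii_add mult.assoc)
qed

lemma klein_minus_inverse:
  assumes "Im \<tau> > 0"
  shows "klein p r (- 1 / \<tau>) = - \<i> * csqrt (- \<i> * \<tau>) * klein r (- p) \<tau>"
proof -
  \<comment> \<open>The inverted characteristic -(1/2 + p) is one unit below 1/2 - p, the form that
    \<open>klein\<close> requires.\<close>
  have "theta (1/2 + r) (- (1/2 + p)) \<tau> =
      exp_pii (2 * (1/2 + r) * of_int (- 1)) * theta (1/2 + r) (1/2 - p) \<tau>"
    by (subst theta_plus_int_right[symmetric]) simp
  then have "klein p r (- 1 / \<tau>) = csqrt (- \<i> * \<tau>) *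
      exp_pii (- p * (r + 1) + 2 * (1/2 + p) * (1/2 + r) + 2 * (1/2 + r) * of_int (- 1)) *
      theta (1/2 + r) (1/2 - p) \<tau>"
    unfolding klein_def theta_minus_inverse[OF assms] by (simp only: exp_pii_add ac_simps)
  also have "- p * (r + 1) + 2 * (1/2 + p) * (1/2 + r) + 2 * (1/2 + r) * of_int (- 1) =
      - 1/2 + (- r * (- p + 1))"
    by (simp add: field_simps)
  also have "exp_pii (- 1/2 + (- r * (- p + 1))) =
      - \<i> * exp_pii (- r * (- p + 1))"
    by (simp only: exp_pii_add exp_pii_minus_half)
  finally show ?thesis
    unfolding klein_def by simp
qed

text \<open>The factor is the sign (-1)^(m n + m + n) times a phase in the determinant n p - m r of
  the rows (p, r) and (m, n). For p and r in fifths this is, up to sign, a fifth root of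
  unity.\<close>

lemma klein_plus_int:
  "klein (p + of_int m) (r + of_int n) \<tau> =
     exp_pii (of_int (m * n + m + n) + n * p - m * r) * klein p r \<tau>"
proof -
  have "theta (1/2 + (p + of_int m)) (1/2 + (r + of_int n)) \<tau> =
      exp_pii (2 * (1/2 + p) * of_int n) * theta (1/2 + p) (1/2 + r) \<tau>"
    unfolding add.assoc[symmetric] by (subst theta_plus_int_left) (rule theta_plus_int_right)
  then have "klein (p + of_int m) (r + of_int n) \<tau> =
      exp_pii (- (p + of_int m) * (r + of_int n + 1) + 2 * (1/2 + p) * of_int n) *
      theta (1/2 + p) (1/2 + r) \<tau>"
    unfolding klein_def by (simp only: exp_pii_add mult.assoc)
  also have "exp_pii (- (p + of_int m) * (r + of_int n + 1) + 2 * (1/2 + p) * of_int n) =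
      exp_pii (of_int (m * n + m + n) + n * p - m * r + (- p * (r + 1)))"
    by (rule exp_pii_eqI[where k = "- m * n - m"]) (simp add: algebra_simps)
  finally show ?thesis
    unfolding klein_def by (simp only: exp_pii_add mult.assoc)
qed

text \<open>Evenness of theta turns both halves into -1/2. Translating each back by one unit is what
  leaves the sign: the underlying theta function is odd in z.\<close>

lemma klein_neg: "klein (- p) (- r) \<tau> = - klein p r \<tau>"
proof -
  have "theta (1/2 + - p) (1/2 + - r) \<tau> = theta (1/2 + p + of_int (- 1)) (1/2 + r + of_int (- 1)) \<tau>"
    by (subst theta_neg[symmetric]) (simp add: algebra_simps)
  also have "\<dots> = exp_pii (2 * (1/2 + p) * of_int (- 1)) * theta (1/2 + p) (1/2 + r) \<tau>"
    by (subst theta_plus_int_left) (rule theta_plus_int_right)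
  finally have "klein (- p) (- r) \<tau> =
      exp_pii (- (- p) * (- r + 1) + 2 * (1/2 + p) * of_int (- 1)) * theta (1/2 + p) (1/2 + r) \<tau>"
    unfolding klein_def by (simp only: exp_pii_add mult.assoc)
  also have "exp_pii (- (- p) * (- r + 1) + 2 * (1/2 + p) * of_int (- 1)) =
      exp_pii (1 + (- p * (r + 1)))"
    by (rule exp_pii_eqI[where k = "- 1"]) (simp add: algebra_simps)
  also have "\<dots> = - exp_pii (- p * (r + 1))"
    unfolding exp_pii_add by (simp add: exp_pii_1)
  finally show ?thesis
    unfolding klein_def by simp
qed

definition klein2 :: "real \<Rightarrow> real \<Rightarrow> real \<Rightarrow> real \<Rightarrow> complex \<Rightarrow> complex" where
  "klein2 p r p' r' \<tau> = klein p r \<tau> * klein p' r' \<tau>"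

lemma klein2_plus_one: "klein2 p r p' r' (\<tau> + 1) = \<i> * klein2 p (p + r) p' (p' + r') \<tau>"
proof -
  have "exp_pii (1/4) * exp_pii (1/4) = \<i>"
    by (simp add: exp_pii_half flip: exp_pii_add)
  then show ?thesis
    unfolding klein2_def klein_plus_one by (simp add: algebra_simps)
qed

lemma klein2_minus_one: "klein2 p r p' r' (\<tau> - 1) = - \<i> * klein2 p (r - p) p' (r' - p') \<tau>"
  using klein2_plus_one[of p "r - p" p' "r' - p'" "\<tau> - 1"] by (simp flip: mult.assoc)

lemma klein2_minus_inverse:
  assumes "Im \<tau> > 0"
  shows "klein2 p r p' r' (- 1 / \<tau>) = \<i> * \<tau> * klein2 r (- p) r' (- p') \<tau>"
proof -
  have "csqrt (- \<i> * \<tau>) * csqrt (- \<i> * \<tau>) = - \<i> * \<tau>"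
    by (metis power2_csqrt power2_eq_square)
  then have "(- \<i> * csqrt (- \<i> * \<tau>)) * (- \<i> * csqrt (- \<i> * \<tau>)) = \<i> * \<tau>"
    by (simp add: algebra_simps)
  then show ?thesis
    unfolding klein2_def klein_minus_inverse[OF assms] by (metis mult.assoc mult.left_commute)
qed

lemma klein2_plus_int:
  "klein2 (p + of_int m) (r + of_int n) (p' + of_int m') (r' + of_int n') \<tau> =
     exp_pii (of_int (m * n + m + n + m' * n' + m' + n') + n * p - m * r + n' * p' - m' * r') *
     klein2 p r p' r' \<tau>"
proof -
  have "of_int (m * n + m + n + m' * n' + m' + n') + n * p - m * r + n' * p' - m' * r' =
    (of_int (m * n + m + n) + n * p - m * r) + (of_int (m' * n' + m' + n') + n' * p' - m' * r')"
    by simp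
  then show ?thesis
    unfolding klein2_def klein_plus_int by (simp only: exp_pii_add ac_simps)
qed

section \<open>The sixth power of the eta multiplier\<close>

definition nu_eta_exponent :: "int \<Rightarrow> int \<Rightarrow> int \<Rightarrow> int \<Rightarrow> int" where
  "nu_eta_exponent a b c d =
     (if odd c then (a + d) * c - b * d * (c^2 - 1) - 3 * c
      else (a + d) * c - b * d * (c^2 - 1) + 3 * d - 3 - 3 * c * d)"

lemma jacobi_square:
  assumes "coprime a n"
  shows "jacobi a n ^ 2 = 1"
proof -
  have "Legendre a p ^ 2 = 1" if "p \<in># prime_factorization n" for p
  proof -
    have "\<not> p dvd a"
      using that assms by (metis coprime_common_divisor in_prime_factors_iff not_prime_unit)
    then show ?thesis by (auto simp: Legendre_def cong_0_iff)
  qed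
  moreover have "prod_mset (image_mset (Legendre a) M) ^ 2 = 1"
    if "\<forall>p \<in># M. Legendre a p ^ 2 = 1" for M
    using that by (induction M) (auto simp: power_mult_distrib)
  ultimately show ?thesis by (simp add: jacobi_def)
qed

text \<open>The Jacobi symbols are 1 or -1, because c and d are coprime, and disappear in an even
  power; pi i / 12 becomes pi i / 2. From here on only the exponent modulo 4 matters.\<close>

lemma nu_eta_power6:
  assumes "a * d - b * c = 1"
  shows "nu_eta a b c d ^ 6 = exp (pi * \<i> / 2 * of_int (nu_eta_exponent a b c d))"
proof -
  have cop: "coprime c d"
    using assms by (intro coprimeI) (metis dvd_diff dvd_mult)
  have upper: "jac_upper d c ^ 2 = 1"
    unfolding jac_upper_def using cop by (intro jacobi_square) (simp add: coprime_commute)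
  have lower: "jac_lower c d ^ 2 = 1"
  proof (cases "c = 0")
    case True
    then have "d \<noteq> 0" using assms by auto
    then show ?thesis using True by (simp add: jac_lower_def sgn_if)
  next
    case False
    then show ?thesis
      using jacobi_square[of c "\<bar>d\<bar>"] cop by (simp add: jac_lower_def power_mult_distrib)
  qed
  have pow: "(of_int x :: complex) ^ 6 = 1" if "x ^ 2 = 1" for x :: int
  proof -
    have "x ^ 6 = (x ^ 2) ^ 3" by simp
    then show ?thesis using that by (simp flip: of_int_power)
  qed
  have exp: "exp (pi * \<i> / 12 * of_int e) ^ 6 = exp (pi * \<i> / 2 * of_int e)" for e :: int
    unfolding exp_of_nat_mult[symmetric] by (intro arg_cong[of _ _ exp]) simp
  show ?thesis
  proof (cases "odd c")
    case True
    show ?thesis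
      unfolding nu_eta_def nu_eta_exponent_def if_P[OF True] power_mult_distrib exp pow[OF upper] by (rule mult_1_left)
  next
    case False
    show ?thesis
      unfolding nu_eta_def nu_eta_exponent_def if_not_P[OF False] power_mult_distrib exp pow[OF lower] by (rule mult_1_left)
  qed
qed

text \<open>T keeps c and hence the branch. For odd c the exponent grows by c^2 up to multiples of
  c^2 - 1, which 4 divides. For even c, c^2 vanishes modulo 4 and the determinant reduces the
  difference to c (a + 3) + 2 b c, where a is odd.\<close>

lemma nu_eta_exponent_T:
  assumes "a * d - b * c = 1"
  shows "[nu_eta_exponent a (a + b) c (c + d) = nu_eta_exponent a b c d + 1] (mod 4)"
proof (cases "odd c")
  case True
  then obtain k where k: "c = 2 * k + 1" by (rule oddE)
  have "nu_eta_exponent a (a + b) c (c + d) - (nu_eta_exponent a b c d + 1) =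
    4 * ((k ^ 2 + k) * (1 - (a + b) * (c + d) + b * d))"
    using True unfolding nu_eta_exponent_def by (simp add: k power2_eq_square algebra_simps)
  then show ?thesis by (simp add: cong_iff_dvd_diff)
next
  case False
  then obtain k where k: "c = 2 * k" by blast
  have "odd a"
  proof
    assume "even a"
    then have "even (a * d - b * c)" using False by simp
    then show False using assms by simp
  qed
  then obtain l where l: "a = 2 * l + 1" by (rule oddE)
  have ad: "a * d = 1 + b * c" using assms by simp
  have "nu_eta_exponent a (a + b) c (c + d) - (nu_eta_exponent a b c d + 1) =
    c ^ 2 - (a * c + a * d + b * c) * (c ^ 2 - 1) + 3 * c - 3 * c ^ 2 - 1"
    using False unfolding nu_eta_exponent_def by (simp add: power2_eq_square algebra_simps)
  also have "\<dots> = c ^ 2 - (a * c + 1 + 2 * b * c) * (c ^ 2 - 1) + 3 * c - 3 * c ^ 2 - 1"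
    unfolding ad by (simp add: algebra_simps)
  also have "\<dots> = 4 * (k ^ 2 - (a * c + 1 + 2 * b * c) * k ^ 2 + k * l + b * k + 2 * k - 3 * k ^ 2)"
    by (simp add: k l power2_eq_square algebra_simps)
  finally show ?thesis by (simp add: cong_iff_dvd_diff)
qed

text \<open>S exchanges the parities in the lower row, so the two branches of the exponent mix. In
  every case the terms of highest degree, b d c^2 - a c d^2 = -c d (a d - b c), collapse to -c
  d.\<close>

lemma nu_eta_exponent_S:
  assumes "a * d - b * c = 1"
  shows "[nu_eta_exponent b (- a) d (- c) = nu_eta_exponent a b c d + 1] (mod 4)"
proof -
  define D where "D = nu_eta_exponent b (- a) d (- c) - (nu_eta_exponent a b c d + 1)"
  have det: "b * (d * c ^ 2) - a * (c * d ^ 2) = - (c * d)"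
  proof -
    have "b * (d * c ^ 2) - a * (c * d ^ 2) = - (c * d) * (a * d - b * c)"
      by (simp add: power2_eq_square algebra_simps)
    then show ?thesis by (simp add: assms)
  qed
  consider "odd c" "odd d" | "odd c" "even d" | "even c" "odd d"
    using assms by (metis dvd_mult dvd_mult2 dvd_diff odd_one)
  then have "4 dvd D"
  proof cases
    case 1
    then obtain k l where kl: "c = 2 * k + 1" "d = 2 * l + 1" by (meson oddE)
    have "D = b * (d * c ^ 2) - a * (c * d ^ 2) - 2 * (c * d) - 3 * d + 3 * c - 1"
      using 1 unfolding D_def nu_eta_exponent_def by (simp add: algebra_simps)
    also have "\<dots> = 4 * (- 3 * ((k + 1) * l) - 1)"
      unfolding det by (simp add: kl algebra_simps)
    finally show ?thesis by simp
  next
    case 2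
    have "D = b * (d * c ^ 2) - a * (c * d ^ 2) + c * d - 4"
      using 2 unfolding D_def nu_eta_exponent_def by (simp add: algebra_simps)
    then show ?thesis unfolding det by simp
  next
    case 3
    then obtain l where l: "d = 2 * l + 1" by (meson oddE)
    have "D = b * (d * c ^ 2) - a * (c * d ^ 2) + c * d - 6 * d + 2"
      using 3 unfolding D_def nu_eta_exponent_def by (simp add: algebra_simps)
    also have "\<dots> = 4 * (- 3 * l - 1)"
      unfolding det by (simp add: l)
    finally show ?thesis by simp
  qed
  then show ?thesis by (simp add: cong_iff_dvd_diff D_def)
qed

lemma exp_exponent_Suc:
  assumes "[e' = e + 1] (mod 4)"
  shows "exp (pi * \<i> / 2 * of_int e') = \<i> * exp (pi * \<i> / 2 * of_int e)"
proof -
  obtain k where k: "e' = e + 1 + 4 * k"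
    using assms by (metis cong_iff_lin mult.commute cong_sym)
  have "exp (pi * \<i> / 2 * of_int e') = exp_pii (1/2 + of_int e / 2)"
    using exp_pii_eqI[of "of_int e' / 2" "1/2 + of_int e / 2" k] by (simp add: exp_pii_def k field_simps)
  also have "\<dots> = \<i> * exp (pi * \<i> / 2 * of_int e)"
    unfolding exp_pii_add exp_pii_half by (simp add: exp_pii_def)
  finally show ?thesis .
qed

section \<open>Modular transformation of products of Klein forms\<close>

text \<open>All vectors and all tau are quantified because multiplying M by T or S on the right
  evaluates the rule for M at tau + 1 or -1/tau, and the rule for the generator then moves the
  vectors already multiplied by M.\<close>

definition klein2_transforms :: "int \<Rightarrow> int \<Rightarrow> int \<Rightarrow> int \<Rightarrow> bool" where
  "klein2_transforms a b c d \<longleftrightarrow> (\<forall>p r p' r' \<tau>. Im \<tau> > 0 \<longrightarrow>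
     klein2 p r p' r' (mobius_act a b c d \<tau>) =
       exp (pi * \<i> / 2 * of_int (nu_eta_exponent a b c d)) * (of_int c * \<tau> + of_int d) *
       klein2 (p * of_int a + r * of_int c) (p * of_int b + r * of_int d)
              (p' * of_int a + r' * of_int c) (p' * of_int b + r' * of_int d) \<tau>)"

lemma klein2_transforms_T:
  assumes "klein2_transforms a b c d" "a * d - b * c = 1"
  shows "klein2_transforms a (a + b) c (c + d)"
  unfolding klein2_transforms_def
proof (intro allI impI)
  fix p r p' r' :: real and \<tau> :: complex assume \<tau>: "Im \<tau> > 0"
  have "mobius_act a (a + b) c (c + d) \<tau> = mobius_act a b c d (\<tau> + 1)"
    by (simp add: mobius_act_def algebra_simps)
  moreover have "Im (\<tau> + 1) > 0" using \<tau> by simp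
  ultimately have "klein2 p r p' r' (mobius_act a (a + b) c (c + d) \<tau>) =
       exp (pi * \<i> / 2 * of_int (nu_eta_exponent a b c d)) * (of_int c * (\<tau> + 1) + of_int d) *
       klein2 (p * of_int a + r * of_int c) (p * of_int b + r * of_int d)
              (p' * of_int a + r' * of_int c) (p' * of_int b + r' * of_int d) (\<tau> + 1)"
    using assms(1) unfolding klein2_transforms_def by metis
  also have "\<dots> = exp (pi * \<i> / 2 * of_int (nu_eta_exponent a (a + b) c (c + d))) * (of_int c * \<tau> + of_int (c + d)) *
       klein2 (p * of_int a + r * of_int c) (p * of_int (a + b) + r * of_int (c + d))
              (p' * of_int a + r' * of_int c) (p' * of_int (a + b) + r' * of_int (c + d)) \<tau>"
    unfolding klein2_plus_one exp_exponent_Suc[OF nu_eta_exponent_T[OF assms(2)]]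
    by (simp add: algebra_simps)
  finally show "klein2 p r p' r' (mobius_act a (a + b) c (c + d) \<tau>) = \<dots>" .
qed

lemma klein2_transforms_T_inverse:
  assumes "klein2_transforms a b c d" "a * d - b * c = 1"
  shows "klein2_transforms a (b - a) c (d - c)"
  unfolding klein2_transforms_def
proof (intro allI impI)
  fix p r p' r' :: real and \<tau> :: complex assume \<tau>: "Im \<tau> > 0"
  have det: "a * (d - c) - (b - a) * c = 1" using assms(2) by (simp add: algebra_simps)
  have "mobius_act a (b - a) c (d - c) \<tau> = mobius_act a b c d (\<tau> - 1)"
    by (simp add: mobius_act_def algebra_simps)
  moreover have "Im (\<tau> - 1) > 0" using \<tau> by simp
  ultimately have "klein2 p r p' r' (mobius_act a (b - a) c (d - c) \<tau>) =
       exp (pi * \<i> / 2 * of_int (nu_eta_exponent a b c d)) * (of_int c * (\<tau> - 1) + of_int d) *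
       klein2 (p * of_int a + r * of_int c) (p * of_int b + r * of_int d)
              (p' * of_int a + r' * of_int c) (p' * of_int b + r' * of_int d) (\<tau> - 1)"
    using assms(1) unfolding klein2_transforms_def by metis
  \<comment> \<open>The increment is applied to M T^(-1), whose product with T is M; the resulting i
    cancels the -i of \<open>klein2_minus_one\<close>.\<close>
  also have "exp (pi * \<i> / 2 * of_int (nu_eta_exponent a b c d)) =
      \<i> * exp (pi * \<i> / 2 * of_int (nu_eta_exponent a (b - a) c (d - c)))"
    using exp_exponent_Suc[OF nu_eta_exponent_T[OF det]] by simp
  finally show "klein2 p r p' r' (mobius_act a (b - a) c (d - c) \<tau>) =
       exp (pi * \<i> / 2 * of_int (nu_eta_exponent a (b - a) c (d - c))) * (of_int c * \<tau> + of_int (d - c)) *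
       klein2 (p * of_int a + r * of_int c) (p * of_int (b - a) + r * of_int (d - c))
              (p' * of_int a + r' * of_int c) (p' * of_int (b - a) + r' * of_int (d - c)) \<tau>"
    unfolding klein2_minus_one by (simp add: algebra_simps)
qed

lemma klein2_transforms_S:
  assumes "klein2_transforms a b c d" "a * d - b * c = 1"
  shows "klein2_transforms b (- a) d (- c)"
  unfolding klein2_transforms_def
proof (intro allI impI)
  fix p r p' r' :: real and \<tau> :: complex assume \<tau>: "Im \<tau> > 0"
  then have nz: "\<tau> \<noteq> 0" by auto
  have "mobius_act a b c d (- 1 / \<tau>) = (\<tau> * (of_int a * (- 1 / \<tau>) + of_int b)) / (\<tau> * (of_int c * (- 1 / \<tau>) + of_int d))"
    using nz unfolding mobius_act_def by (rule mult_divide_mult_cancel_left[symmetric])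
  also have "\<dots> = mobius_act b (- a) d (- c) \<tau>"
    using nz by (simp add: mobius_act_def algebra_simps)
  finally have "mobius_act b (- a) d (- c) \<tau> = mobius_act a b c d (- 1 / \<tau>)" ..
  moreover have "Im (- 1 / \<tau>) > 0"
    using \<tau> by (auto simp: Im_divide intro!: divide_pos_pos sum_power2_gt_zero_iff[THEN iffD2])
  ultimately have "klein2 p r p' r' (mobius_act b (- a) d (- c) \<tau>) =
       exp (pi * \<i> / 2 * of_int (nu_eta_exponent a b c d)) * (of_int c * (- 1 / \<tau>) + of_int d) *
       klein2 (p * of_int a + r * of_int c) (p * of_int b + r * of_int d)
              (p' * of_int a + r' * of_int c) (p' * of_int b + r' * of_int d) (- 1 / \<tau>)"
    using assms(1) unfolding klein2_transforms_def by metis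
  also have "\<dots> = (\<i> * exp (pi * \<i> / 2 * of_int (nu_eta_exponent a b c d))) * (\<tau> * (of_int c * (- 1 / \<tau>) + of_int d)) *
       klein2 (p * of_int b + r * of_int d) (- (p * of_int a + r * of_int c))
              (p' * of_int b + r' * of_int d) (- (p' * of_int a + r' * of_int c)) \<tau>"
    unfolding klein2_minus_inverse[OF \<tau>] by (simp only: ac_simps)
  also have "\<tau> * (of_int c * (- 1 / \<tau>) + of_int d) = of_int d * \<tau> + of_int (- c)"
    using nz by (simp add: algebra_simps)
  finally show "klein2 p r p' r' (mobius_act b (- a) d (- c) \<tau>) =
       exp (pi * \<i> / 2 * of_int (nu_eta_exponent b (- a) d (- c))) * (of_int d * \<tau> + of_int (- c)) *
       klein2 (p * of_int b + r * of_int d) (p * of_int (- a) + r * of_int (- c))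
              (p' * of_int b + r' * of_int d) (p' * of_int (- a) + r' * of_int (- c)) \<tau>"
    unfolding exp_exponent_Suc[OF nu_eta_exponent_S[OF assms(2)]] by simp
qed

lemma klein2_transforms_T_power:
  assumes "klein2_transforms a b c d" "a * d - b * c = 1"
  shows "klein2_transforms a (b + k * a) c (d + k * c)"
proof (induction k rule: int_induct[where k = 0])
  case base
  then show ?case using assms by simp
next
  case (step1 i)
  have "a * (d + i * c) - (b + i * a) * c = 1" using assms(2) by (simp add: algebra_simps)
  from klein2_transforms_T[OF step1.IH this] show ?case by (simp add: algebra_simps)
next
  case (step2 i)
  have "a * (d + i * c) - (b + i * a) * c = 1" using assms(2) by (simp add: algebra_simps)
  from klein2_transforms_T_inverse[OF step2.IH this] show ?case by (simp add: algebra_simps)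
qed

text \<open>Euclidean algorithm on the lower row: a power of T replaces d by its remainder modulo c,
  and S moves this remainder to the place of c, where the induction hypothesis applies.\<close>

theorem klein2_transforms_SL2:
  assumes "a * d - b * c = 1"
  shows "klein2_transforms a b c d"
  using assms
proof (induction "nat \<bar>c\<bar>" arbitrary: a b c d rule: less_induct)
  case less
  show ?case
  proof (cases "c = 0")
    case True
    then have "a = d \<and> (d = 1 \<or> d = - 1)"
      using less.prems by (auto simp: zmult_eq_1_iff)
    moreover have "klein2_transforms 1 0 0 1"
      by (simp add: klein2_transforms_def mobius_act_def nu_eta_exponent_def)
    moreover have "klein2_transforms (- 1) 0 0 (- 1)"
    proof -
      \<comment> \<open>For -I the exponent is -6. Its value -1 cancels the factor d = -1, in
        accordance with a product of two odd forms being even.\<close>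
      have "exp (pi * \<i> / 2 * of_int (- 6)) = - 1"
        using exp_pii_eqI[of "- 3" 1 "- 2"] by (simp add: exp_pii_def algebra_simps)
      then show ?thesis
        by (simp add: klein2_transforms_def mobius_act_def nu_eta_exponent_def klein2_def klein_neg)
    qed
    \<comment> \<open>As d^2 = 1, the power b d of T applied to d times the identity has upper right
      entry b.\<close>
    ultimately show ?thesis
      using klein2_transforms_T_power[of d 0 0 d "b * d"] True by auto
  next
    case False
    define k where "k = - (d div c)"
    define b' where "b' = b + k * a"
    define d' where "d' = d + k * c"
    have det: "a * d' - b' * c = 1"
      using less.prems by (simp add: b'_def d'_def algebra_simps)
    have "d' = d mod c"
      by (simp add: d'_def k_def minus_div_mult_eq_mod)
    then have "nat \<bar>d'\<bar> < nat \<bar>c\<bar>"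
      using False abs_mod_less[of c d] by simp
    then have "klein2_transforms b' (- a) d' (- c)"
      using det by (intro less.hyps) (simp_all add: algebra_simps)
    \<comment> \<open>S has order four, so three more applications of S undo the first one.\<close>
    then have "klein2_transforms (- a) (- b') (- c) (- d')"
      using klein2_transforms_S[of b' "- a" d' "- c"] det by (simp add: algebra_simps)
    then have "klein2_transforms (- b') a (- d') c"
      using klein2_transforms_S[of "- a" "- b'" "- c" "- d'"] det by (simp add: algebra_simps)
    then have "klein2_transforms a b' c d'"
      using klein2_transforms_S[of "- b'" a "- d'" c] det by (simp add: algebra_simps)
    from klein2_transforms_T_power[OF this det, of "- k"] show ?thesis
      by (simp add: b'_def d'_def)
  qed
qed

section \<open>The vectors of Q under Gamma_(theta,5)\<close>

definition Q_klein :: "complex \<Rightarrow> complex" where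
  "Q_klein = klein2 (- 1/5) (- 1/5) (- 1/5) (1/5)"

text \<open>The halved characteristics are 3/10 = 1/2 - 1/5 and 7/10 = 1/2 + 1/5. The phase does not
  depend on tau, so it cancels from the transformation law.\<close>

lemma Q_klein_eq: "Q_klein \<tau> = exp_pii (2/5) * Qf \<tau>"
proof -
  have "klein (- 1/5) (- 1/5) \<tau> = exp_pii (4/25) * theta (3/10) (3/10) \<tau>"
       "klein (- 1/5) (1/5) \<tau> = exp_pii (6/25) * theta (3/10) (7/10) \<tau>"
    by (simp_all add: klein_def)
  moreover have "exp_pii (2/5) = exp_pii (4/25) * exp_pii (6/25)"
    by (simp flip: exp_pii_add)
  ultimately show ?thesis
    by (simp add: Q_klein_def klein2_def Qf_def theta_char_eq_theta)
qed

lemma klein2_neg: "klein2 (- p) (- r) (- p') (- r') \<tau> = klein2 p r p' r' \<tau>"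
  by (simp add: klein2_def klein_neg)

text \<open>Reduces each congruence class to arithmetic. The images of the two vectors split into
  representatives (p, r), (p', r') and integer shifts; s records the sign relating the
  representatives to \<open>Q_klein\<close>, and k the even integer by which the total phase differs
  from E / 5.\<close>

lemma Qf_mobius_act:
  fixes E s p r p' r' :: real and m n m' n' k :: int
  assumes det: "a * d - b * c = 1" and tau: "Im \<tau> > 0"
    and args: "- of_int (a + c) / 5 = p + of_int m" "- of_int (b + d) / 5 = r + of_int n"
      "of_int (c - a) / 5 = p' + of_int m'" "of_int (d - b) / 5 = r' + of_int n'"
    and base: "klein2 p r p' r' \<tau> = exp_pii s * Q_klein \<tau>"
    and E: "of_int (m * n + m + n + m' * n' + m' + n') + n * p - m * r + n' * p' - m' * r' + s =
      E / 5 + 2 * of_int k"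
  shows "Qf (mobius_act a b c d \<tau>) =
    nu_eta a b c d ^ 6 * exp (pi * \<i> / 5 * of_real E) * (of_int c * \<tau> + of_int d) * Qf \<tau>"
proof -
  have "Q_klein (mobius_act a b c d \<tau>) = nu_eta a b c d ^ 6 * (of_int c * \<tau> + of_int d) *
      klein2 (- of_int (a + c) / 5) (- of_int (b + d) / 5) (of_int (c - a) / 5) (of_int (d - b) / 5) \<tau>"
    using klein2_transforms_SL2[OF det] tau
    unfolding klein2_transforms_def Q_klein_def nu_eta_power6[OF det]
    by (simp add: diff_divide_distrib add_divide_distrib)
  also have "klein2 (- of_int (a + c) / 5) (- of_int (b + d) / 5) (of_int (c - a) / 5) (of_int (d - b) / 5) \<tau> =
      exp_pii (E / 5 + 2 * of_int k) * Q_klein \<tau>"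
    unfolding args klein2_plus_int base E[symmetric] by (simp only: exp_pii_add mult.assoc)
  also have "exp_pii (E / 5 + 2 * of_int k) = exp (pi * \<i> / 5 * of_real E)"
    using exp_pii_eqI[OF refl, of "E / 5" k] by (simp add: exp_pii_def)
  finally show ?thesis
    unfolding Q_klein_eq by (simp add: exp_pii_def)
qed

theorem mainTheorem8:
  fixes a b c d :: int and \<tau> :: complex
  assumes M: "in_Gamma_theta5 a b c d"
    and tau: "Im \<tau> > 0"
  shows "([a = 1] (mod 5) \<and> [b = 0] (mod 5) \<and> [c = 0] (mod 5) \<and> [d = 1] (mod 5) \<longrightarrow>
           Qf (mobius_act a b c d \<tau>) =
             nu_eta a b c d ^ 6 * exp (pi * \<i> / 5 *
               of_real (- 6 * b / 5 - 2 * a * b / 5 - 2 * c * d / 5))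
             * (of_int c * \<tau> + of_int d) * Qf \<tau>)
       \<and> ([a = -1] (mod 5) \<and> [b = 0] (mod 5) \<and> [c = 0] (mod 5) \<and> [d = -1] (mod 5) \<longrightarrow>
           Qf (mobius_act a b c d \<tau>) =
             nu_eta a b c d ^ 6 * exp (pi * \<i> / 5 *
               of_real (- 24 * b / 5 - 2 * a * b / 5 - 2 * c * d / 5))
             * (of_int c * \<tau> + of_int d) * Qf \<tau>)
       \<and> ([a = 0] (mod 5) \<and> [b = -1] (mod 5) \<and> [c = 1] (mod 5) \<and> [d = 0] (mod 5) \<longrightarrow>
           Qf (mobius_act a b c d \<tau>) =
             nu_eta a b c d ^ 6 * exp (pi * \<i> / 5 *
               of_real (- 5 - 6 * d / 5 - 2 * a * b / 5 - 2 * c * d / 5))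
             * (of_int c * \<tau> + of_int d) * Qf \<tau>)
       \<and> ([a = 0] (mod 5) \<and> [b = 1] (mod 5) \<and> [c = -1] (mod 5) \<and> [d = 0] (mod 5) \<longrightarrow>
           Qf (mobius_act a b c d \<tau>) =
             nu_eta a b c d ^ 6 * exp (pi * \<i> / 5 *
               of_real (- 5 + 6 * d / 5 - 2 * a * b / 5 - 2 * c * d / 5))
             * (of_int c * \<tau> + of_int d) * Qf \<tau>)"
proof -
  have det: "a * d - b * c = 1"
    using M by (simp add: in_Gamma_theta5_def)
  have cong: "\<exists>k. x = y + 5 * k" if "[x = y] (mod 5)" for x y :: int
    using that by (metis cong_iff_lin cong_sym)
  show ?thesis
  proof (intro conjI impI; elim conjE)
    assume "[a = 1] (mod 5)" "[b = 0] (mod 5)" "[c = 0] (mod 5)" "[d = 1] (mod 5)"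
    then obtain A B C D where abcd: "a = 1 + 5 * A" "b = 5 * B" "c = 5 * C" "d = 1 + 5 * D"
      by (metis cong add_0)
    have base: "klein2 (- 1/5) (- 1/5) (- 1/5) (1/5) \<tau> = exp_pii 0 * Q_klein \<tau>"
      by (simp add: Q_klein_def exp_pii_def)
    \<comment> \<open>Here m n + m' n' = 2 A B + 2 C D, whereas E / 5 contains -2 A B - 2 C D; k is
      half of the total difference.\<close>
    show "Qf (mobius_act a b c d \<tau>) = nu_eta a b c d ^ 6 * exp (pi * \<i> / 5 *
        of_real (- 6 * b / 5 - 2 * a * b / 5 - 2 * c * d / 5)) * (of_int c * \<tau> + of_int d) * Qf \<tau>"
      by (rule Qf_mobius_act[OF det tau _ _ _ _ base, where m = "- A - C" and n = "- B - D"
            and m' = "C - A" and n' = "D - B" and k = "2 * A * B + 2 * C * D - A"])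
         (simp_all add: abcd field_simps)
  next
    assume "[a = -1] (mod 5)" "[b = 0] (mod 5)" "[c = 0] (mod 5)" "[d = -1] (mod 5)"
    then obtain A B C D where abcd: "a = - 1 + 5 * A" "b = 5 * B" "c = 5 * C" "d = - 1 + 5 * D"
      by (metis cong add_0)
    \<comment> \<open>Both vectors are negated, so the two signs cancel.\<close>
    have base: "klein2 (1/5) (1/5) (1/5) (- 1/5) \<tau> = exp_pii 0 * Q_klein \<tau>"
      using klein2_neg[of "1/5" "1/5" "1/5" "- 1/5"] by (simp add: Q_klein_def exp_pii_def)
    \<comment> \<open>The shifts produce -12 B / 5 and E / 5 contains -22 B / 5; the gap 2 B is the
      summand B of k.\<close>
    show "Qf (mobius_act a b c d \<tau>) = nu_eta a b c d ^ 6 * exp (pi * \<i> / 5 *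
        of_real (- 24 * b / 5 - 2 * a * b / 5 - 2 * c * d / 5)) * (of_int c * \<tau> + of_int d) * Qf \<tau>"
      by (rule Qf_mobius_act[OF det tau _ _ _ _ base, where m = "- A - C" and n = "- B - D"
            and m' = "C - A" and n' = "D - B" and k = "2 * A * B + 2 * C * D - A + B"])
         (simp_all add: abcd field_simps)
  next
    assume "[a = 0] (mod 5)" "[b = -1] (mod 5)" "[c = 1] (mod 5)" "[d = 0] (mod 5)"
    then obtain A B C D where abcd: "a = 5 * A" "b = - 1 + 5 * B" "c = 1 + 5 * C" "d = 5 * D"
      by (metis cong add_0)
    \<comment> \<open>The first vector goes to the second, and the second to minus the first. The
      single sign is \<open>exp_pii 1\<close>, matching the -5 in E: 1 and -5/5 differ by 2, which
      gives the summand 1 of k.\<close>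
    have base: "klein2 (- 1/5) (1/5) (1/5) (1/5) \<tau> = exp_pii 1 * Q_klein \<tau>"
      using klein_neg[of "1/5" "1/5"] by (simp add: Q_klein_def klein2_def exp_pii_1)
    show "Qf (mobius_act a b c d \<tau>) = nu_eta a b c d ^ 6 * exp (pi * \<i> / 5 *
        of_real (- 5 - 6 * d / 5 - 2 * a * b / 5 - 2 * c * d / 5)) * (of_int c * \<tau> + of_int d) * Qf \<tau>"
      by (rule Qf_mobius_act[OF det tau _ _ _ _ base, where m = "- A - C" and n = "- B - D"
            and m' = "C - A" and n' = "D - B" and k = "2 * A * B + 2 * C * D - A - B + D + 1"])
         (simp_all add: abcd field_simps)
  next
    assume "[a = 0] (mod 5)" "[b = 1] (mod 5)" "[c = -1] (mod 5)" "[d = 0] (mod 5)"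
    then obtain A B C D where abcd: "a = 5 * A" "b = 1 + 5 * B" "c = - 1 + 5 * C" "d = 5 * D"
      by (metis cong add_0)
    \<comment> \<open>Now the first vector goes to minus the second and the second to the first,
      again with one sign.\<close>
    have base: "klein2 (1/5) (- 1/5) (- 1/5) (- 1/5) \<tau> = exp_pii 1 * Q_klein \<tau>"
      using klein_neg[of "- 1/5" "1/5"] by (simp add: Q_klein_def klein2_def exp_pii_1)
    show "Qf (mobius_act a b c d \<tau>) = nu_eta a b c d ^ 6 * exp (pi * \<i> / 5 *
        of_real (- 5 + 6 * d / 5 - 2 * a * b / 5 - 2 * c * d / 5)) * (of_int c * \<tau> + of_int d) * Qf \<tau>"
      by (rule Qf_mobius_act[OF det tau _ _ _ _ base, where m = "- A - C" and n = "- B - D"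
            and m' = "C - A" and n' = "D - B" and k = "2 * A * B + 2 * C * D - A - B - D + 1"])
         (simp_all add: abcd field_simps)
  qed
qed

end
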